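(* Let $X$ be a finitely generated simplicial set, let $Y$ be a simplicial set with finitely many simplices in each dimension, and let $X=A\cup B$ be a union of two simplicial subsets. A simplicial distribution $p:X\to D(Y)$ is a vertex of $\mathrm{sDist}(X,Y)$ if and only if $p$ is the unique simplicial distribution on $(X,Y)$ whose restrictions to $A$ and $B$ lie in $\mathrm{conv}(\mathrm{Vsupp}(p|_A))$ and $\mathrm{conv}(\mathrm{Vsupp}(p|_B))$, respectively.
   Context: For a set $U$, $D(U)$ is the set of functions $p:U\to\mathbb{R}_{\geq 0}$ with finite support and $\sum_{u\in U}p(u)=1$; for a function $f:U\to V$, $D(f):D(U)\to D(V)$ is the push-forward $D(f)(p)(v)=\sum_{u\in f^{-1}(v)}p(u)$. For a simplicial set $Y$, $D(Y)$ is the simplicial set with $D(Y)_n=D(Y_n)$ and structure maps $D(d_i)$, $D(s_j)$. A simplicial distribution on $(X,Y)$ is a simplicial map $p:X\to D(Y)$; the set of these is $\mathrm{sDist}(X,Y)$, convex under simplex-wise convex combinations. Write $p_x^y=p_x(y)$ for $x\in X_n$, $y\in Y_n$. For a simplicial subset $A\subseteq X$, $p|_A\in\mathrm{sDist}(A,Y)$ is the restriction. A vertex is a $p$ such that $p=\alpha q+(1-\alpha)\tilde q$ with $q,\tilde q\in \mathrm{sDist}(X,Y)$ and $0<\alpha\leq 1$ implies $p=q$. For $p,q\in\mathrm{sDist}(X,Y)$, $q\preceq p$ means: for all $n\geq0$, $x\in X_n$, $y\in Y_n$, $q_x^y\neq0$ implies $p_x^y\neq 0$. The vertex support $\mathrm{Vsupp}(p)$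 is the set of vertices $q$ of $\mathrm{sDist}(X,Y)$ with $q\preceq p$ (and for $p|_A$, the same with $A$ in place of $X$). $\mathrm{conv}$ denotes convex hull. $X$ finitely generated means that it is generated by finitely many simplices (equivalently, it has finitely many non-degenerate simplices). *)

theory Defs
  imports "HOL-Analysis.Analysis" "HOL-Library.Function_Algebras"
begin

section \<open>Functions as a real vector space\<close>

text \<open>
  With the pointwise operations, families of distributions live in a real vector space, so that
  convex combinations and \<^const>\<open>hull\<close> of the library apply to them.
\<close>

instantiation "fun" :: (type, real_vector) real_vector
begin

definition scaleR_fun :: "real \<Rightarrow> ('a \<Rightarrow> 'b) \<Rightarrow> 'a \<Rightarrow> 'b"
  where "scaleR_fun c f = (\<lambda>x. c *\<^sub>R f x)"

instance
  by standard (auto simp: scaleR_fun_def plus_fun_def scaleR_add_left scaleR_add_right)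

end

lemma scaleR_fun_apply [simp]: "(c *\<^sub>R f) x = c *\<^sub>R f x"
  by (simp add: scaleR_fun_def)


section \<open>Simplicial sets\<close>

text \<open>
  The index \<open>n\<close> of a structure map is the dimension of the lower of the two sets involved:
  \<open>face X n i\<close> is \<open>d\<^sub>i : X\<^sub>n\<^sub>+\<^sub>1 \<rightarrow> X\<^sub>n\<close> (for \<open>i \<le> n + 1\<close>) and
  \<open>degen X n j\<close> is \<open>s\<^sub>j : X\<^sub>n \<rightarrow> X\<^sub>n\<^sub>+\<^sub>1\<close> (for \<open>j \<le> n\<close>).
\<close>

record 'a sset =
  simplices :: "nat \<Rightarrow> 'a set"
  face :: "nat \<Rightarrow> nat \<Rightarrow> 'a \<Rightarrow> 'a"
  degen :: "nat \<Rightarrow> nat \<Rightarrow> 'a \<Rightarrow> 'a"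

definition simplicial_set :: "'a sset \<Rightarrow> bool" where
  "simplicial_set X \<longleftrightarrow>
     (\<forall>n i. i \<le> Suc n \<longrightarrow> face X n i \<in> simplices X (Suc n) \<rightarrow> simplices X n) \<and>
     (\<forall>n j. j \<le> n \<longrightarrow> degen X n j \<in> simplices X n \<rightarrow> simplices X (Suc n)) \<and>
     (\<forall>n i j. \<forall>x\<in>simplices X (Suc (Suc n)). i < j \<and> j \<le> Suc (Suc n) \<longrightarrow>
        face X n i (face X (Suc n) j x) = face X n (j - 1) (face X (Suc n) i x)) \<and>
     (\<forall>n i j. \<forall>x\<in>simplices X (Suc n). i < j \<and> j \<le> Suc n \<longrightarrow>
        face X (Suc n) i (degen X (Suc n) j x) = degen X n (j - 1) (face X n i x)) \<and>
     (\<forall>n j. \<forall>x\<in>simplices X n. j \<le> n \<longrightarrow>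
        face X n j (degen X n j x) = x \<and> face X n (Suc j) (degen X n j x) = x) \<and>
     (\<forall>n i j. \<forall>x\<in>simplices X (Suc n). Suc j < i \<and> i \<le> Suc (Suc n) \<longrightarrow>
        face X (Suc n) i (degen X (Suc n) j x) = degen X n j (face X n (i - 1) x)) \<and>
     (\<forall>n i j. \<forall>x\<in>simplices X n. i \<le> j \<and> j \<le> n \<longrightarrow>
        degen X (Suc n) i (degen X n j x) = degen X (Suc n) (Suc j) (degen X n i x))"

definition simplicial_map :: "'a sset \<Rightarrow> 'b sset \<Rightarrow> (nat \<Rightarrow> 'a \<Rightarrow> 'b) \<Rightarrow> bool" where
  "simplicial_map X Z f \<longleftrightarrow>
     (\<forall>n. f n \<in> simplices X n \<rightarrow> simplices Z n) \<and>
     (\<forall>n i. \<forall>x\<in>simplices X (Suc n). i \<le> Suc n \<longrightarrow> f n (face X n i x) = face Z n i (f (Suc n) x)) \<and>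
     (\<forall>n j. \<forall>x\<in>simplices X n. j \<le> n \<longrightarrow> f (Suc n) (degen X n j x) = degen Z n j (f n x))"

definition simplicial_subset :: "'a sset \<Rightarrow> (nat \<Rightarrow> 'a set) \<Rightarrow> bool" where
  "simplicial_subset X A \<longleftrightarrow>
     (\<forall>n. A n \<subseteq> simplices X n) \<and>
     (\<forall>n i. i \<le> Suc n \<longrightarrow> face X n i \<in> A (Suc n) \<rightarrow> A n) \<and>
     (\<forall>n j. j \<le> n \<longrightarrow> degen X n j \<in> A n \<rightarrow> A (Suc n))"

definition subsset :: "'a sset \<Rightarrow> (nat \<Rightarrow> 'a set) \<Rightarrow> 'a sset" where
  "subsset X A = X\<lparr>simplices := A\<rparr>"

definition finitely_generated :: "'a sset \<Rightarrow> bool" where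
  "finitely_generated X \<longleftrightarrow>
     (\<exists>G. finite G \<and> G \<subseteq> (SIGMA n:UNIV. simplices X n) \<and>
        (\<forall>A. simplicial_subset X A \<and> (\<forall>(n, x)\<in>G. x \<in> A n) \<longrightarrow> A = simplices X))"


section \<open>Distributions\<close>

text \<open>A function on \<open>U\<close> is represented by its extension by zero to the whole type.\<close>

definition distributions :: "'a set \<Rightarrow> ('a \<Rightarrow> real) set" where
  "distributions U =
     {p. (\<forall>u. 0 \<le> p u) \<and> (\<forall>u. u \<notin> U \<longrightarrow> p u = 0) \<and> finite {u. p u \<noteq> 0} \<and> (\<Sum>u | p u \<noteq> 0. p u) = 1}"

text \<open>
  The sum runs over the part of the fibre lying in the support of \<open>p\<close>, since the fibre itself
  may be infinite.
\<close>

definition pushforward :: "('a \<Rightarrow> 'b) \<Rightarrow> ('a \<Rightarrow> real) \<Rightarrow> 'b \<Rightarrow> real" where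
  "pushforward f p = (\<lambda>v. \<Sum>u | p u \<noteq> 0 \<and> f u = v. p u)"

definition dist_sset :: "'b sset \<Rightarrow> ('b \<Rightarrow> real) sset" where
  "dist_sset Y =
     \<lparr>simplices = \<lambda>n. distributions (simplices Y n),
      face = \<lambda>n i. pushforward (face Y n i),
      degen = \<lambda>n j. pushforward (degen Y n j)\<rparr>"


section \<open>Simplicial distributions\<close>

text \<open>
  Outside the simplices of \<open>X\<close> a simplicial distribution takes the junk value zero, so that
  equality of simplicial distributions is equality in HOL and restriction sets values to zero.
\<close>

definition sDist :: "'a sset \<Rightarrow> 'b sset \<Rightarrow> (nat \<Rightarrow> 'a \<Rightarrow> 'b \<Rightarrow> real) set" where
  "sDist X Y = {p. simplicial_map X (dist_sset Y) p \<and> (\<forall>n x. x \<notin> simplices X n \<longrightarrow> p n x = 0)}"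

definition sdist_restrict ::
  "(nat \<Rightarrow> 'a \<Rightarrow> 'b \<Rightarrow> real) \<Rightarrow> (nat \<Rightarrow> 'a set) \<Rightarrow> nat \<Rightarrow> 'a \<Rightarrow> 'b \<Rightarrow> real" where
  "sdist_restrict p A = (\<lambda>n x. if x \<in> A n then p n x else 0)"

definition is_vertex :: "'a sset \<Rightarrow> 'b sset \<Rightarrow> (nat \<Rightarrow> 'a \<Rightarrow> 'b \<Rightarrow> real) \<Rightarrow> bool" where
  "is_vertex X Y p \<longleftrightarrow> p \<in> sDist X Y \<and>
     (\<forall>q\<in>sDist X Y. \<forall>q'\<in>sDist X Y. \<forall>\<alpha>::real.
        0 < \<alpha> \<and> \<alpha> \<le> 1 \<and> p = \<alpha> *\<^sub>R q + (1 - \<alpha>) *\<^sub>R q' \<longrightarrow> p = q)"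

definition sdist_le ::
  "'a sset \<Rightarrow> 'b sset \<Rightarrow> (nat \<Rightarrow> 'a \<Rightarrow> 'b \<Rightarrow> real) \<Rightarrow> (nat \<Rightarrow> 'a \<Rightarrow> 'b \<Rightarrow> real) \<Rightarrow> bool" where
  "sdist_le X Y q p \<longleftrightarrow>
     (\<forall>n. \<forall>x\<in>simplices X n. \<forall>y\<in>simplices Y n. q n x y \<noteq> 0 \<longrightarrow> p n x y \<noteq> 0)"

definition Vsupp ::
  "'a sset \<Rightarrow> 'b sset \<Rightarrow> (nat \<Rightarrow> 'a \<Rightarrow> 'b \<Rightarrow> real) \<Rightarrow> (nat \<Rightarrow> 'a \<Rightarrow> 'b \<Rightarrow> real) set" where
  "Vsupp X Y p = {q. is_vertex X Y q \<and> sdist_le X Y q p}"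

end

theory Submission
  imports Defs
begin

text \<open>
  Over a finitely generated simplicial set, a family of functions compatible with the structure
  maps is determined by its values on the generators, and it is nonnegative as soon as it is
  nonnegative there. Hence one can move from \<open>p\<close> in a direction \<open>q - q'\<close> supported on the support
  of \<open>p\<close> until a coordinate of a generator vanishes. Doing so in both directions of a segment
  through a non-vertex \<open>p\<close>, and inducting on the size of the support on the generators, gives
  \<open>p \<in> conv (Vsupp p)\<close>; applied to \<open>q|\<^sub>A\<close> and \<open>q|\<^sub>B\<close> (\<open>A\<close> and \<open>B\<close> are again finitely
  generated, since all simplices above some dimension are degenerate) this shows that they lie
  in the two convex hulls exactly when \<open>q \<preceq> p\<close>. Finally, \<open>p\<close> is a vertex
  exactly when \<open>q \<preceq> p\<close> forces \<open>q = p\<close>.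
\<close>

section \<open>Subobjects of finitely generated simplicial sets\<close>

lemma simplices_subsset [simp]: "simplices (subsset X A) = A"
  and face_subsset [simp]: "face (subsset X A) = face X"
  and degen_subsset [simp]: "degen (subsset X A) = degen X"
  by (simp_all add: subsset_def)

lemma simplicial_set_face:
  "simplicial_set X \<Longrightarrow> i \<le> Suc n \<Longrightarrow> x \<in> simplices X (Suc n) \<Longrightarrow> face X n i x \<in> simplices X n"
  by (simp add: simplicial_set_def Pi_iff)

lemma simplicial_set_degen:
  "simplicial_set X \<Longrightarrow> j \<le> n \<Longrightarrow> x \<in> simplices X n \<Longrightarrow> degen X n j x \<in> simplices X (Suc n)"
  by (simp add: simplicial_set_def Pi_iff)

lemma face_degen_same:
  assumes "simplicial_set X" "x \<in> simplices X n" "j \<le> n"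
  shows "face X n j (degen X n j x) = x" "face X n (Suc j) (degen X n j x) = x"
  using assms by (simp_all add: simplicial_set_def)

lemma face_degen_less:
  assumes "simplicial_set X" "x \<in> simplices X (Suc n)" "i < j" "j \<le> Suc n"
  shows "face X (Suc n) i (degen X (Suc n) j x) = degen X n (j - 1) (face X n i x)"
  using assms by (simp add: simplicial_set_def)

lemma face_degen_greater:
  assumes "simplicial_set X" "x \<in> simplices X (Suc n)" "Suc j < i" "i \<le> Suc (Suc n)"
  shows "face X (Suc n) i (degen X (Suc n) j x) = degen X n j (face X n (i - 1) x)"
  using assms by (simp add: simplicial_set_def)

lemma simplicial_subset_subset: "simplicial_subset X A \<Longrightarrow> x \<in> A n \<Longrightarrow> x \<in> simplices X n"
  unfolding simplicial_subset_def by blast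

lemma simplicial_subset_face:
  "simplicial_subset X A \<Longrightarrow> i \<le> Suc n \<Longrightarrow> x \<in> A (Suc n) \<Longrightarrow> face X n i x \<in> A n"
  unfolding simplicial_subset_def by blast

lemma simplicial_subset_degen:
  "simplicial_subset X A \<Longrightarrow> j \<le> n \<Longrightarrow> x \<in> A n \<Longrightarrow> degen X n j x \<in> A (Suc n)"
  unfolding simplicial_subset_def by blast

lemma simplicial_subsetI:
  assumes "\<And>n x. x \<in> A n \<Longrightarrow> x \<in> simplices X n"
    and "\<And>n x i. x \<in> A (Suc n) \<Longrightarrow> i \<le> Suc n \<Longrightarrow> face X n i x \<in> A n"
    and "\<And>n x j. x \<in> A n \<Longrightarrow> j \<le> n \<Longrightarrow> degen X n j x \<in> A (Suc n)"
  shows "simplicial_subset X A"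
  unfolding simplicial_subset_def by (intro conjI allI impI subsetI Pi_I assms)

lemma simplicial_set_subsset:
  assumes "simplicial_set X" "simplicial_subset X A"
  shows "simplicial_set (subsset X A)"
proof -
  have "\<And>n. A n \<subseteq> simplices X n"
    using assms(2) by (simp add: simplicial_subset_def)
  then show ?thesis
    using assms unfolding simplicial_set_def simplicial_subset_def
    by (simp add: subset_iff)
qed

section \<open>Normal form: degeneracies of iterated faces of generators\<close>

inductive_set iterated_faces :: "'a sset \<Rightarrow> (nat \<times> 'a) set \<Rightarrow> (nat \<times> 'a) set"
  for X G where
    base: "(n, x) \<in> G \<Longrightarrow> (n, x) \<in> iterated_faces X G"
  | step: "(Suc n, x) \<in> iterated_faces X G \<Longrightarrow> i \<le> Suc n \<Longrightarrow> (n, face X n i x) \<in> iterated_faces X G"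

lemma iterated_faces_bound:
  "(n, x) \<in> iterated_faces X G \<Longrightarrow> \<exists>m y. (m, y) \<in> G \<and> n \<le> m"
proof (induction rule: iterated_faces.induct)
  case (base n x)
  then show ?case by blast
next
  case (step n x i)
  then show ?case using Suc_leD by blast
qed

text \<open>Taking faces lowers the dimension, so no iterated face lies above the top generator, and
  each level arises from finitely many generators and finitely many faces of the level
  above.\<close>

lemma finite_iterated_faces:
  assumes "finite G"
  shows "finite {x. (n, x) \<in> iterated_faces X G}"
proof -
  obtain N where N: "\<And>m y. (m, y) \<in> G \<Longrightarrow> m < N"
  proof -
    \<comment> \<open>If \<open>G\<close> is empty, \<open>Max\<close> is unspecified, but the bound
      is then vacuous.\<close>
    have "\<forall>m\<in>fst ` G. m < Suc (Max (fst ` G))"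
      using assms by (simp add: le_imp_less_Suc)
    then show ?thesis
      by (intro that[of "Suc (Max (fst ` G))"]) force
  qed
  show ?thesis
  \<comment> \<open>Downward induction on the dimension, starting from the empty levels
    \<open>n \<ge> N\<close>.\<close>
  proof (induction "N - n" arbitrary: n rule: less_induct)
    case less
    show ?case
    proof (cases "n < N")
      case False
      then have "{x. (n, x) \<in> iterated_faces X G} = {}"
        using iterated_faces_bound[of n _ X G] N by fastforce
      then show ?thesis by simp
    next
      case True
      let ?S = "{x. (Suc n, x) \<in> iterated_faces X G}"
      have "finite ?S" using less True by simp
      moreover have "{x. (n, x) \<in> iterated_faces X G}
          \<subseteq> snd ` G \<union> (\<Union>i\<in>{..Suc n}. face X n i ` ?S)"
        by (auto elim: iterated_faces.cases) (force elim: iterated_faces.cases)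
      ultimately show ?thesis
        using assms by (meson finite_UN finite_UnI finite_atMost finite_imageI finite_subset)
    qed
  qed
qed

text \<open>Recursion on the dimension is possible because every degeneracy raises it by one. Only
  degeneracies are applied here; closure under faces is inherited from \<open>F\<close>.\<close>

fun degeneracy_closure :: "'a sset \<Rightarrow> (nat \<times> 'a) set \<Rightarrow> nat \<Rightarrow> 'a set" where
  "degeneracy_closure X F 0 = {x. (0, x) \<in> F}"
| "degeneracy_closure X F (Suc n) =
     {x. (Suc n, x) \<in> F} \<union> (\<Union>j\<in>{..n}. degen X n j ` degeneracy_closure X F n)"

lemma degeneracy_closure_base: "(n, x) \<in> F \<Longrightarrow> x \<in> degeneracy_closure X F n"
  by (cases n) auto

lemma degeneracy_closure_degen:
  "x \<in> degeneracy_closure X F n \<Longrightarrow> j \<le> n \<Longrightarrow> degen X n j x \<in> degeneracy_closure X F (Suc n)"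
  by auto

lemma degeneracy_closure_SucE:
  assumes "x \<in> degeneracy_closure X F (Suc n)"
  obtains "(Suc n, x) \<in> F"
    | y j where "y \<in> degeneracy_closure X F n" "j \<le> n" "x = degen X n j y"
  using assms by auto

lemma degeneracy_closure_simplices:
  assumes "simplicial_set X" "F \<subseteq> (SIGMA n:UNIV. simplices X n)"
  shows "degeneracy_closure X F n \<subseteq> simplices X n"
proof (induction n)
  case 0
  show ?case using assms(2) by (simp add: subset_iff)
next
  case (Suc n)
  show ?case
  proof
    fix x assume "x \<in> degeneracy_closure X F (Suc n)"
    then show "x \<in> simplices X (Suc n)"
    proof (cases rule: degeneracy_closure_SucE)
      case 1
      then show ?thesis using assms(2) by blast
    next
      case (2 y j)
      then show ?thesis using Suc simplicial_set_degen[OF assms(1)] by (metis subsetD)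
    qed
  qed
qed

text \<open>The simplicial identities either cancel a face against the outermost degeneracy or
  exchange the two, leaving a degeneracy of a face of a simplex one dimension lower, where the
  induction hypothesis applies.\<close>

lemma degeneracy_closure_face:
  assumes X: "simplicial_set X" and F: "F \<subseteq> (SIGMA n:UNIV. simplices X n)"
    and closed: "\<And>n x i. (Suc n, x) \<in> F \<Longrightarrow> i \<le> Suc n \<Longrightarrow> (n, face X n i x) \<in> F"
  shows "x \<in> degeneracy_closure X F (Suc n) \<Longrightarrow> i \<le> Suc n \<Longrightarrow>
    face X n i x \<in> degeneracy_closure X F n"
proof (induction n arbitrary: x i)
  \<comment> \<open>A degenerate simplex of dimension 1 has the form \<open>degen X 0 0 y\<close>,
    and both of its faces are \<open>y\<close>.\<close>
  case 0
  from 0(1) show ?case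
  proof (cases rule: degeneracy_closure_SucE)
    case 1
    show ?thesis by (rule degeneracy_closure_base[OF closed[OF 1 0(2)]])
  next
    case (2 y j)
    have "y \<in> simplices X 0"
      using degeneracy_closure_simplices[OF X F] 2(1) by (rule subsetD)
    then have "face X 0 0 x = y" "face X 0 (Suc 0) x = y"
      using 2(2,3) face_degen_same[OF X, of y 0 0] by simp_all
    moreover have "i = 0 \<or> i = Suc 0" using 0(2) by (simp add: le_Suc_eq)
    ultimately show ?thesis using 2(1) by metis
  qed
next
  case (Suc n)
  from Suc.prems(1) show ?case
  proof (cases rule: degeneracy_closure_SucE)
    case 1
    show ?thesis by (rule degeneracy_closure_base[OF closed[OF 1 Suc.prems(2)]])
  next
    case (2 y j)
    have y: "y \<in> simplices X (Suc n)"
      using degeneracy_closure_simplices[OF X F] 2(1) by (rule subsetD)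
    \<comment> \<open>The face cancels in the first case; exchanging lowers the degeneracy index in
      the second and the face index in the third.\<close>
    consider "i = j \<or> i = Suc j" | "i < j" | "Suc j < i" by linarith
    then show ?thesis
    proof cases
      case 1
      then have "face X (Suc n) i x = y"
        using face_degen_same[OF X y 2(2)] 2(3) by blast
      then show ?thesis using 2(1) by simp
    next
      case less: 2
      then have "face X n i y \<in> degeneracy_closure X F n" "j - 1 \<le> n"
        using Suc.IH[OF 2(1), of i] 2(2) by simp_all
      then show ?thesis
        using face_degen_less[OF X y less 2(2)] 2(3) degeneracy_closure_degen by metis
    next
      case greater: 3
      then have "face X n (i - 1) y \<in> degeneracy_closure X F n" "j \<le> n"
        using Suc.IH[OF 2(1), of "i - 1"] Suc.prems(2) by simp_all
      then show ?thesis
        using face_degen_greater[OF X y greater Suc.prems(2)] 2(3) degeneracy_closure_degen by metis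
    qed
  qed
qed

lemma finite_degeneracy_closure:
  assumes "\<And>n. finite {x. (n, x) \<in> F}"
  shows "finite (degeneracy_closure X F n)"
  by (induction n) (use assms in auto)

text \<open>Degeneracies of iterated faces of the generators form a simplicial subset containing the
  generators, hence all of \<open>X\<close>. Each level of it is finite, and above the top generator
  dimension it contains only degenerate simplices.\<close>

lemma finitely_generated_skeletal:
  assumes X: "simplicial_set X" and fg: "finitely_generated X"
  shows "finite (simplices X n)"
    and "\<exists>N. \<forall>n\<ge>N. simplices X (Suc n) = (\<Union>j\<in>{..n}. degen X n j ` simplices X n)"
proof -
  obtain G where G: "finite G" "G \<subseteq> (SIGMA n:UNIV. simplices X n)"
    and gen: "\<And>A. simplicial_subset X A \<Longrightarrow> \<forall>(n, x)\<in>G. x \<in> A n \<Longrightarrow> A = simplices X"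
    using fg unfolding finitely_generated_def by blast
  let ?F = "iterated_faces X G"
  let ?C = "degeneracy_closure X ?F"
  have "x \<in> simplices X n" if "(n, x) \<in> ?F" for n x
    using that
  proof (induction rule: iterated_faces.induct)
    case (base n x)
    then show ?case using G(2) by auto
  next
    case (step n x i)
    then show ?case using simplicial_set_face[OF X] by simp
  qed
  then have F: "?F \<subseteq> (SIGMA n:UNIV. simplices X n)" by auto
  have "simplicial_subset X ?C"
  proof (rule simplicial_subsetI)
    show "face X n i x \<in> ?C n" if "x \<in> ?C (Suc n)" "i \<le> Suc n" for n x i
      by (rule degeneracy_closure_face[OF X F _ that]) (rule iterated_faces.step)
  qed (rule subsetD[OF degeneracy_closure_simplices[OF X F]] degeneracy_closure_degen; assumption)+
  moreover have "\<forall>(n, x)\<in>G. x \<in> ?C n"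
    by (auto intro: degeneracy_closure_base iterated_faces.base)
  ultimately have C: "?C = simplices X" by (rule gen)
  show "finite (simplices X n)"
    using finite_degeneracy_closure[OF finite_iterated_faces[OF G(1)]] C by metis
  obtain N where N: "\<And>m y. (m, y) \<in> G \<Longrightarrow> m \<le> N"
  proof -
    have "\<forall>m\<in>fst ` G. m \<le> Max (fst ` G)" using G by simp
    then show ?thesis by (intro that[of "Max (fst ` G)"]) force
  qed
  have "simplices X (Suc n) = (\<Union>j\<in>{..n}. degen X n j ` simplices X n)" if "N \<le> n" for n
  proof -
    \<comment> \<open>Iterated faces never exceed the top generator dimension, so only degeneracies
      contribute to dimension \<open>Suc n\<close>.\<close>
    have "{x. (Suc n, x) \<in> ?F} = {}"
      using iterated_faces_bound[of "Suc n" _ X G] N that by fastforce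
    then have "?C (Suc n) = (\<Union>j\<in>{..n}. degen X n j ` ?C n)" by simp
    then show ?thesis unfolding C .
  qed
  then show "\<exists>N. \<forall>n\<ge>N. simplices X (Suc n) = (\<Union>j\<in>{..n}. degen X n j ` simplices X n)"
    by blast
qed

text \<open>The generators are all simplices of \<open>A\<close> of dimension at most
  \<open>N\<close>, where \<open>N\<close> is such that every simplex of \<open>X\<close> above
  dimension \<open>N\<close> is degenerate.\<close>

lemma finitely_generated_subsset:
  assumes X: "simplicial_set X" and fg: "finitely_generated X" and A: "simplicial_subset X A"
  shows "finitely_generated (subsset X A)"
proof -
  obtain N where N: "\<And>n. n \<ge> N \<Longrightarrow> simplices X (Suc n) = (\<Union>j\<in>{..n}. degen X n j ` simplices X n)"
    using finitely_generated_skeletal(2)[OF X fg] by blast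
  have "finite (A n)" for n
    using A finitely_generated_skeletal(1)[OF X fg, of n]
    unfolding simplicial_subset_def by (meson finite_subset)
  then have "finite (SIGMA n:{..N}. A n)" by blast
  moreover have "S = A"
    if S: "simplicial_subset (subsset X A) S" and gen: "\<forall>(n, x)\<in>(SIGMA n:{..N}. A n). x \<in> S n" for S
  proof -
    have "A n \<subseteq> S n" for n
    proof (induction n)
      case 0
      then show ?case using gen by auto
    next
      case (Suc n)
      show ?case
      proof (cases "Suc n \<le> N")
        case True
        then show ?thesis using gen by auto
      next
        case False
        show ?thesis
        proof
          fix x assume x: "x \<in> A (Suc n)"
          then have "x \<in> simplices X (Suc n)" using A by (blast dest: simplicial_subset_subset)
          then obtain j y where y: "j \<le> n" "y \<in> simplices X n" "x = degen X n j y"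
            using N[of n] False by auto
          \<comment> \<open>\<open>y\<close> is a face of \<open>x\<close> and therefore lies in \<open>A\<close>.\<close>
          then have "y = face X n j x" using face_degen_same[OF X] by simp
          then have "y \<in> A n" using simplicial_subset_face[OF A _ x, of j] y by simp
          then have "y \<in> S n" using Suc by blast
          then show "x \<in> S (Suc n)" using simplicial_subset_degen[OF S, of j n y] y by simp
        qed
      qed
    qed
    moreover have "S n \<subseteq> A n" for n
      using S by (simp add: simplicial_subset_def)
    ultimately show ?thesis by (intro ext) blast
  qed
  ultimately show ?thesis
    unfolding finitely_generated_def
    by (intro exI[of _ "SIGMA n:{..N}. A n"]) auto
qed


section \<open>Simplicial distributions\<close>

text \<open>Summing over a fixed finite set instead of the support, which varies with
  \<open>p\<close>, makes the push-forward visibly linear.\<close>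

lemma pushforward_eq_sum:
  assumes "finite U" "\<And>u. u \<notin> U \<Longrightarrow> p u = 0"
  shows "pushforward f p v = (\<Sum>u | u \<in> U \<and> f u = v. p u)"
  unfolding pushforward_def
  by (rule sum.mono_neutral_left) (use assms in auto)

lemma sDist_distributions:
  "q \<in> sDist X Y \<Longrightarrow> x \<in> simplices X n \<Longrightarrow> q n x \<in> distributions (simplices Y n)"
  unfolding sDist_def simplicial_map_def dist_sset_def by auto

lemma sDist_outside: "q \<in> sDist X Y \<Longrightarrow> x \<notin> simplices X n \<Longrightarrow> q n x = 0"
  unfolding sDist_def by auto

lemma sDist_nonneg: "q \<in> sDist X Y \<Longrightarrow> 0 \<le> q n x y"
  by (cases "x \<in> simplices X n")
    (auto dest: sDist_distributions sDist_outside simp: distributions_def)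

lemma sDist_eq_0: "q \<in> sDist X Y \<Longrightarrow> y \<notin> simplices Y n \<Longrightarrow> q n x y = 0"
  by (cases "x \<in> simplices X n")
    (auto dest: sDist_distributions sDist_outside simp: distributions_def)

lemma sDist_sum:
  assumes "q \<in> sDist X Y" "x \<in> simplices X n" "finite (simplices Y n)"
  shows "(\<Sum>y\<in>simplices Y n. q n x y) = 1"
proof -
  have "(\<Sum>y | q n x y \<noteq> 0. q n x y) = (\<Sum>y\<in>simplices Y n. q n x y)"
    using assms(3) sDist_eq_0[OF assms(1)] by (intro sum.mono_neutral_left) auto
  then show ?thesis
    using sDist_distributions[OF assms(1,2)] by (simp add: distributions_def)
qed

lemma sDist_face:
  "q \<in> sDist X Y \<Longrightarrow> x \<in> simplices X (Suc n) \<Longrightarrow> i \<le> Suc n \<Longrightarrow>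
    q n (face X n i x) = pushforward (face Y n i) (q (Suc n) x)"
  unfolding sDist_def simplicial_map_def dist_sset_def by simp

lemma sDist_degen:
  "q \<in> sDist X Y \<Longrightarrow> x \<in> simplices X n \<Longrightarrow> j \<le> n \<Longrightarrow>
    q (Suc n) (degen X n j x) = pushforward (degen Y n j) (q n x)"
  unfolding sDist_def simplicial_map_def dist_sset_def by simp

lemma sDistI:
  assumes "\<And>n x. x \<notin> simplices X n \<Longrightarrow> q n x = 0"
    and "\<And>n x. x \<in> simplices X n \<Longrightarrow> q n x \<in> distributions (simplices Y n)"
    and "\<And>n x i. x \<in> simplices X (Suc n) \<Longrightarrow> i \<le> Suc n \<Longrightarrow>
      q n (face X n i x) = pushforward (face Y n i) (q (Suc n) x)"
    and "\<And>n x j. x \<in> simplices X n \<Longrightarrow> j \<le> n \<Longrightarrow>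
      q (Suc n) (degen X n j x) = pushforward (degen Y n j) (q n x)"
  shows "q \<in> sDist X Y"
  using assms unfolding sDist_def simplicial_map_def dist_sset_def by simp

section \<open>The support preorder\<close>

lemma sdist_le_iff:
  assumes "q \<in> sDist X Y"
  shows "sdist_le X Y q p \<longleftrightarrow> (\<forall>n x y. p n x y = 0 \<longrightarrow> q n x y = 0)"
  using sDist_outside[OF assms] sDist_eq_0[OF assms] unfolding sdist_le_def
  by (metis zero_fun_apply)

lemma sdist_le_refl: "sdist_le X Y p p"
  by (simp add: sdist_le_def)

lemma Vsupp_mono: "sdist_le X Y p p' \<Longrightarrow> Vsupp X Y p \<subseteq> Vsupp X Y p'"
  by (auto simp: Vsupp_def sdist_le_def)

text \<open>The relation only demands that certain coordinates vanish, so it cuts out a convex set,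
  and this set contains the vertex support.\<close>

lemma convex_hull_Vsupp_le:
  assumes "q \<in> convex hull (Vsupp X Y p)"
  shows "sdist_le X Y q p"
proof -
  have "convex {q. sdist_le X Y q p}"
    unfolding sdist_le_def by (rule convexI) (simp, metis add_0 mult_zero_right)
  then have "convex hull (Vsupp X Y p) \<subseteq> {q. sdist_le X Y q p}"
    by (intro hull_minimal) (auto simp: Vsupp_def)
  then show ?thesis using assms by blast
qed

text \<open>Nonnegativity rules out cancellation: a positive coordinate of \<open>q\<close> keeps a
  positive contribution.\<close>

lemma sdist_le_convex_combination:
  assumes "q \<in> sDist X Y" "q' \<in> sDist X Y" "0 < \<alpha>" "\<alpha> \<le> 1"
  shows "sdist_le X Y q (\<alpha> *\<^sub>R q + (1 - \<alpha>) *\<^sub>R q')"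
  unfolding sdist_le_def
proof (intro allI ballI impI)
  fix n x y assume "q n x y \<noteq> 0"
  then have "0 < q n x y" using sDist_nonneg[OF assms(1), of n x y] by simp
  then have "0 < \<alpha> * q n x y + (1 - \<alpha>) * q' n x y"
    using sDist_nonneg[OF assms(2), of n x y] assms by (simp add: add_pos_nonneg)
  then show "(\<alpha> *\<^sub>R q + (1 - \<alpha>) *\<^sub>R q') n x y \<noteq> 0" by simp
qed

lemma sdist_restrict_in_sDist:
  assumes q: "q \<in> sDist X Y" and A: "simplicial_subset X A"
  shows "sdist_restrict q A \<in> sDist (subsset X A) Y"
proof (rule sDistI)
  fix n x assume "x \<in> simplices (subsset X A) n"
  then show "sdist_restrict q A n x \<in> distributions (simplices Y n)"
    using sDist_distributions[OF q] A by (auto simp: sdist_restrict_def dest: simplicial_subset_subset)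
next
  fix n x i assume "x \<in> simplices (subsset X A) (Suc n)" "i \<le> Suc n"
  then show "sdist_restrict q A n (face (subsset X A) n i x)
      = pushforward (face Y n i) (sdist_restrict q A (Suc n) x)"
    using sDist_face[OF q] A
    by (auto simp: sdist_restrict_def dest: simplicial_subset_subset simplicial_subset_face)
next
  fix n x j assume "x \<in> simplices (subsset X A) n" "j \<le> n"
  then show "sdist_restrict q A (Suc n) (degen (subsset X A) n j x)
      = pushforward (degen Y n j) (sdist_restrict q A n x)"
    using sDist_degen[OF q] A
    by (auto simp: sdist_restrict_def dest: simplicial_subset_subset simplicial_subset_degen)
qed (auto simp: sdist_restrict_def)

lemma sdist_le_restrict:
  assumes "simplicial_subset X A" "sdist_le X Y q p"
  shows "sdist_le (subsset X A) Y (sdist_restrict q A) (sdist_restrict p A)"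
  using assms by (auto simp: sdist_le_def sdist_restrict_def dest: simplicial_subset_subset)


section \<open>Moving to the boundary\<close>

text \<open>The ratio test of linear programming: along \<open>d\<close>, the first coordinate to
  reach zero has the smallest ratio \<open>p e / - d e\<close> among the decreasing ones. The ratios
  are positive because \<open>d\<close> vanishes wherever \<open>p\<close> does.\<close>

lemma exists_boundary_step:
  fixes p d :: "'e \<Rightarrow> real"
  assumes E: "finite E" and p: "\<And>e. e \<in> E \<Longrightarrow> 0 \<le> p e"
    and supp: "\<And>e. e \<in> E \<Longrightarrow> p e = 0 \<Longrightarrow> d e = 0" and neg: "\<exists>e\<in>E. d e < 0"
  shows "\<exists>t>0. (\<forall>e\<in>E. 0 \<le> p e + t * d e) \<and> (\<exists>e\<in>E. p e \<noteq> 0 \<and> p e + t * d e = 0)"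
proof -
  let ?N = "{e\<in>E. d e < 0}"
  let ?R = "(\<lambda>e. p e / - d e) ` ?N"
  have R: "finite ?R" "?R \<noteq> {}" using E neg by auto
  have pos: "0 < p e" if "e \<in> ?N" for e
    using that p[of e] supp[of e] by (auto simp: less_le)
  have "Min ?R \<in> ?R" using R by (rule Min_in)
  then obtain e where e: "e \<in> ?N" "Min ?R = p e / - d e" by auto
  have t: "0 < Min ?R" using e pos[OF e(1)] by (simp add: divide_pos_neg)
  have "0 \<le> p u + Min ?R * d u" if u: "u \<in> E" for u
  proof (cases "d u < 0")
    case True
    then have "Min ?R \<le> p u / - d u" using R(1) u by (intro Min_le) auto
    then have "Min ?R * - d u \<le> p u" using True by (simp only: pos_le_divide_eq neg_0_less_iff_less)
    then show ?thesis by simp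
  next
    case False
    then show ?thesis using p[OF u] t by simp
  qed
  moreover have "e \<in> E" "p e \<noteq> 0" "p e + Min ?R * d e = 0"
    using e pos[OF e(1)] by auto
  ultimately show ?thesis using t by blast
qed

text \<open>The weights are inversely proportional to the step lengths \<open>s\<close> and
  \<open>t\<close>, so the two displacements cancel.\<close>

lemma convex_combination_opposite:
  fixes p d :: "'v :: real_vector"
  assumes "0 < s" "0 < t"
  shows "(t / (s + t)) *\<^sub>R (p + s *\<^sub>R d) + (1 - t / (s + t)) *\<^sub>R (p - t *\<^sub>R d) = p"
proof -
  have "1 - t / (s + t) = s / (s + t)" using assms by (simp add: field_simps)
  then have "(t / (s + t)) * s = (1 - t / (s + t)) * t" by simp
  then show ?thesis
    by (simp add: scaleR_add_right scaleR_diff_right scaleR_diff_left del: times_divide_eq_left)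
qed

section \<open>Simplicial distributions over a fixed finite generating set\<close>

locale generated_sset =
  fixes X :: "'a sset" and Y :: "'b sset" and G :: "(nat \<times> 'a) set"
  assumes X: "simplicial_set X" and finite_Y: "finite (simplices Y n)"
    and finite_G: "finite G" and G_simplices: "(n, x) \<in> G \<Longrightarrow> x \<in> simplices X n"
    and generates: "simplicial_subset X S \<Longrightarrow> (\<And>n x. (n, x) \<in> G \<Longrightarrow> x \<in> S n) \<Longrightarrow> S = simplices X"
begin

text \<open>The simplices satisfying \<open>P\<close> form a simplicial subset containing
  \<open>G\<close>.\<close>

lemma generator_induct [consumes 1, case_names generator face degen]:
  assumes "x \<in> simplices X n"
    and "\<And>n x. (n, x) \<in> G \<Longrightarrow> P n x"
    and "\<And>n x i. x \<in> simplices X (Suc n) \<Longrightarrow> i \<le> Suc n \<Longrightarrow> P (Suc n) x \<Longrightarrow> P n (face X n i x)"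
    and "\<And>n x j. x \<in> simplices X n \<Longrightarrow> j \<le> n \<Longrightarrow> P n x \<Longrightarrow> P (Suc n) (degen X n j x)"
  shows "P n x"
proof -
  have "simplicial_subset X (\<lambda>n. {x \<in> simplices X n. P n x})"
    by (rule simplicial_subsetI)
      (simp_all add: assms(3,4) simplicial_set_face[OF X] simplicial_set_degen[OF X])
  then have "(\<lambda>n. {x \<in> simplices X n. P n x}) = simplices X"
    by (rule generates) (use G_simplices assms(2) in blast)
  then show ?thesis using assms(1) by (metis (mono_tags, lifting) mem_Collect_eq)
qed

lemma sDist_eqI:
  assumes q: "q \<in> sDist X Y" and q': "q' \<in> sDist X Y"
    and eq: "\<And>n x. (n, x) \<in> G \<Longrightarrow> q n x = q' n x"
  shows "q = q'"
proof (intro ext)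
  fix n x y
  show "q n x y = q' n x y"
  proof (cases "x \<in> simplices X n")
    case True
    then have "q n x = q' n x"
      by (induction rule: generator_induct)
        (simp_all add: eq sDist_face[OF q] sDist_face[OF q'] sDist_degen[OF q] sDist_degen[OF q'])
    then show ?thesis by simp
  qed (simp add: sDist_outside[OF q] sDist_outside[OF q'])
qed

text \<open>The difference \<open>q - q'\<close> has total mass 0 on every simplex and push-forwards
  are linear, so normalisation and compatibility survive the translation. Nonnegativity spreads from
  the generators because push-forwards preserve it.\<close>

lemma sDist_translate:
  assumes p: "p \<in> sDist X Y" and q: "q \<in> sDist X Y" and q': "q' \<in> sDist X Y"
    and nonneg: "\<And>n x y. (n, x) \<in> G \<Longrightarrow> y \<in> simplices Y n \<Longrightarrow> 0 \<le> (p + t *\<^sub>R (q - q')) n x y"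
  shows "p + t *\<^sub>R (q - q') \<in> sDist X Y" (is "?r \<in> _")
proof -
  have zero: "?r n x y = 0" if "y \<notin> simplices Y n" for n x y
    using that by (simp add: sDist_eq_0[OF p] sDist_eq_0[OF q] sDist_eq_0[OF q'])
  \<comment> \<open>Linearity: all four push-forwards become sums over the same part of the fibre,
    the one inside \<open>simplices Y n\<close>.\<close>
  have push: "pushforward f (?r n x)
      = (\<lambda>v. pushforward f (p n x) v + t * (pushforward f (q n x) v - pushforward f (q' n x) v))" for f :: "'b \<Rightarrow> 'b" and n x
  proof
    fix v
    let ?U = "{u. u \<in> simplices Y n \<and> f u = v}"
    have "pushforward f (?r n x) v = (\<Sum>u\<in>?U. ?r n x u)"
      by (rule pushforward_eq_sum[OF finite_Y zero])
    also have "\<dots> = sum (p n x) ?U + t * (sum (q n x) ?U - sum (q' n x) ?U)"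
      by (simp add: sum.distrib sum_subtractf flip: sum_distrib_left)
    also have "sum (p n x) ?U = pushforward f (p n x) v"
      by (rule pushforward_eq_sum[OF finite_Y sDist_eq_0[OF p], symmetric])
    also have "sum (q n x) ?U = pushforward f (q n x) v"
      by (rule pushforward_eq_sum[OF finite_Y sDist_eq_0[OF q], symmetric])
    also have "sum (q' n x) ?U = pushforward f (q' n x) v"
      by (rule pushforward_eq_sum[OF finite_Y sDist_eq_0[OF q'], symmetric])
    finally show "pushforward f (?r n x) v
      = pushforward f (p n x) v + t * (pushforward f (q n x) v - pushforward f (q' n x) v)" .
  qed
  have r_face: "?r n (face X n i x) = pushforward (face Y n i) (?r (Suc n) x)"
    if "x \<in> simplices X (Suc n)" "i \<le> Suc n" for n i x
    unfolding push using that by (auto simp: sDist_face[OF p] sDist_face[OF q] sDist_face[OF q'])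
  have r_degen: "?r (Suc n) (degen X n j x) = pushforward (degen Y n j) (?r n x)"
    if "x \<in> simplices X n" "j \<le> n" for n j x
    unfolding push using that by (auto simp: sDist_degen[OF p] sDist_degen[OF q] sDist_degen[OF q'])
  have push_nonneg: "\<forall>v. 0 \<le> pushforward f s v" if "\<forall>u. 0 \<le> s u" for f :: "'b \<Rightarrow> 'b" and s
    unfolding pushforward_def using that by (auto intro: sum_nonneg)
  have pos: "\<forall>y. 0 \<le> ?r n x y" if "x \<in> simplices X n" for n x
    using that
  proof (induction rule: generator_induct)
    case (generator n x)
    show ?case
    proof
      fix y show "0 \<le> ?r n x y"
        using nonneg[OF generator, of y] zero[of y n x] by (cases "y \<in> simplices Y n") auto
    qed
  next
    case (face n x i)
    show ?case
      unfolding r_face[OF face(1,2)]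
      by (rule push_nonneg) (rule face)
  next
    case (degen n x j)
    show ?case
      unfolding r_degen[OF degen(1,2)]
      by (rule push_nonneg) (rule degen)
  qed
  show ?thesis
  proof (rule sDistI)
    fix n x assume x: "x \<in> simplices X n"
    \<comment> \<open>The total mass is \<open>1 + t * (1 - 1)\<close>.\<close>
    have "(\<Sum>y\<in>simplices Y n. ?r n x y) = 1"
      using sDist_sum[OF p x finite_Y] sDist_sum[OF q x finite_Y] sDist_sum[OF q' x finite_Y]
      by (simp add: sum.distrib sum_subtractf flip: sum_distrib_left)
    moreover have "(\<Sum>y | ?r n x y \<noteq> 0. ?r n x y) = (\<Sum>y\<in>simplices Y n. ?r n x y)"
      using finite_Y zero by (intro sum.mono_neutral_left) blast+
    moreover have "finite {y. ?r n x y \<noteq> 0}"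
      using zero by (intro finite_subset[OF _ finite_Y[of n]]) blast
    ultimately show "?r n x \<in> distributions (simplices Y n)"
      using pos[OF x] zero unfolding distributions_def by simp
  qed (use r_face r_degen in \<open>simp_all add: sDist_outside[OF p] sDist_outside[OF q] sDist_outside[OF q']\<close>)
qed

text \<open>Its cardinality is the induction measure; recording generators only keeps it
  finite.\<close>

definition generator_support :: "(nat \<Rightarrow> 'a \<Rightarrow> 'b \<Rightarrow> real) \<Rightarrow> (nat \<times> 'a \<times> 'b) set" where
  "generator_support p = {(n, x, y). (n, x) \<in> G \<and> y \<in> simplices Y n \<and> p n x y \<noteq> 0}"

lemma finite_generator_coordinates:
  "finite {(n, x, y). (n, x) \<in> G \<and> y \<in> simplices Y n}"
proof -
  have "{(n, x, y). (n, x) \<in> G \<and> y \<in> simplices Y n}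
      = (\<lambda>((n, x), y). (n, x, y)) ` (SIGMA g:G. simplices Y (fst g))"
    by force
  then show ?thesis using finite_G finite_Y by simp
qed

text \<open>Both have mass 1 on each generator. If \<open>q\<close> were nowhere smaller, the
  nonnegative differences would sum to zero, forcing equality on the generators and hence
  everywhere.\<close>

lemma exists_generator_less:
  assumes q: "q \<in> sDist X Y" and q': "q' \<in> sDist X Y" and "q \<noteq> q'"
  shows "\<exists>n x y. (n, x) \<in> G \<and> y \<in> simplices Y n \<and> q n x y < q' n x y"
proof (rule ccontr)
  assume "\<not> ?thesis"
  then have ge: "q' n x y \<le> q n x y" if "(n, x) \<in> G" "y \<in> simplices Y n" for n x y
    using that by (meson not_le)
  have "q n x = q' n x" if g: "(n, x) \<in> G" for n x
  proof
    fix y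
    have x: "x \<in> simplices X n" using g by (rule G_simplices)
    have "(\<Sum>y\<in>simplices Y n. q n x y - q' n x y) = 0"
      using sDist_sum[OF q x finite_Y] sDist_sum[OF q' x finite_Y] by (simp add: sum_subtractf)
    then have "\<forall>y\<in>simplices Y n. q n x y - q' n x y = 0"
      using ge[OF g] by (subst (asm) sum_nonneg_eq_0_iff) (simp_all add: finite_Y)
    then show "q n x y = q' n x y"
      using sDist_eq_0[OF q] sDist_eq_0[OF q'] by (cases "y \<in> simplices Y n") auto
  qed
  then show False using sDist_eqI[OF q q'] \<open>q \<noteq> q'\<close> by blast
qed

text \<open>Both \<open>q\<close> and \<open>q'\<close> vanish wherever \<open>p\<close> does, so
  the translation creates no new support, while the boundary step removes a coordinate of a
  generator.\<close>

lemma exists_translate_smaller_support: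
  assumes p: "p \<in> sDist X Y" and q: "q \<in> sDist X Y" and q': "q' \<in> sDist X Y" and "q \<noteq> q'"
    and le: "sdist_le X Y q p" "sdist_le X Y q' p"
  shows "\<exists>t>0. p + t *\<^sub>R (q - q') \<in> sDist X Y \<and> sdist_le X Y (p + t *\<^sub>R (q - q')) p
    \<and> card (generator_support (p + t *\<^sub>R (q - q'))) < card (generator_support p)"
proof -
  let ?E = "{(n, x, y). (n, x) \<in> G \<and> y \<in> simplices Y n}"
  have supp: "q n x y = 0" "q' n x y = 0" if "p n x y = 0" for n x y
    using le that by (simp_all add: sdist_le_iff[OF q] sdist_le_iff[OF q'])
  obtain t where t: "0 < t"
    and nonneg: "\<forall>(n, x, y)\<in>?E. 0 \<le> p n x y + t * (q n x y - q' n x y)"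
    and hit: "\<exists>(n, x, y)\<in>?E. p n x y \<noteq> 0 \<and> p n x y + t * (q n x y - q' n x y) = 0"
    \<comment> \<open>The decreasing coordinate along \<open>q - q'\<close> comes from
      \<open>exists_generator_less\<close>.\<close>
    using exists_boundary_step[OF finite_generator_coordinates, of
        "\<lambda>(n, x, y). p n x y" "\<lambda>(n, x, y). q n x y - q' n x y"]
      exists_generator_less[OF q q' \<open>q \<noteq> q'\<close>] sDist_nonneg[OF p] supp
    by (auto simp: case_prod_unfold)
  let ?r = "p + t *\<^sub>R (q - q')"
  have le': "?r n x y = 0" if "p n x y = 0" for n x y
    using supp[OF that] that by simp
  have "generator_support ?r \<subset> generator_support p"
  proof (rule psubsetI)
    show "generator_support ?r \<subseteq> generator_support p"
      using le' unfolding generator_support_def by blast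
    show "generator_support ?r \<noteq> generator_support p"
      using hit unfolding generator_support_def by (auto simp: set_eq_iff)
  qed
  moreover have "finite (generator_support p)"
    by (rule finite_subset[OF _ finite_generator_coordinates]) (auto simp: generator_support_def)
  ultimately have "card (generator_support ?r) < card (generator_support p)"
    by (rule psubset_card_mono[rotated])
  moreover have "?r \<in> sDist X Y"
    by (rule sDist_translate[OF p q q']) (use nonneg in auto)
  moreover have "sdist_le X Y ?r p"
    using le' unfolding sdist_le_def by blast
  ultimately show ?thesis using t by blast
qed

lemma in_convex_hull_Vsupp:
  "p \<in> sDist X Y \<Longrightarrow> p \<in> convex hull (Vsupp X Y p)"
proof (induction "card (generator_support p)" arbitrary: p rule: less_induct)
  case less
  show ?case
  proof (cases "is_vertex X Y p")
    case True
    then show ?thesis by (intro hull_inc) (simp add: Vsupp_def sdist_le_refl)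
  next
    case False
    then obtain q q' \<alpha> where q: "q \<in> sDist X Y" "q' \<in> sDist X Y" and \<alpha>: "0 < \<alpha>" "\<alpha> \<le> 1"
      and p: "p = \<alpha> *\<^sub>R q + (1 - \<alpha>) *\<^sub>R q'" and "p \<noteq> q"
      using less.prems unfolding is_vertex_def by blast
    \<comment> \<open>With \<open>\<alpha> = 1\<close> or \<open>q = q'\<close> the combination
      would collapse to \<open>q\<close>.\<close>
    have "\<alpha> \<noteq> 1" using p \<open>p \<noteq> q\<close> by auto
    have "q \<noteq> q'" using p \<open>p \<noteq> q\<close> by (auto simp flip: scaleR_add_left)
    have le: "sdist_le X Y q p"
      unfolding p by (rule sdist_le_convex_combination[OF q \<alpha>])
    \<comment> \<open>Exchanging the roles gives \<open>q'\<close> the weight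
      \<open>1 - \<alpha>\<close>, which is positive.\<close>
    have "sdist_le X Y q' ((1 - \<alpha>) *\<^sub>R q' + (1 - (1 - \<alpha>)) *\<^sub>R q)"
      by (rule sdist_le_convex_combination[OF q(2,1)]) (use \<alpha> \<open>\<alpha> \<noteq> 1\<close> in auto)
    then have le': "sdist_le X Y q' p" by (simp add: p add.commute)
    \<comment> \<open>The induction hypothesis puts \<open>r\<close> in the hull of its own vertex
      support, which is contained in that of \<open>p\<close>.\<close>
    have hull: "r \<in> convex hull (Vsupp X Y p)"
      if "r \<in> sDist X Y" "sdist_le X Y r p" "card (generator_support r) < card (generator_support p)" for r
      using less.hyps[OF that(3,1)] hull_mono[OF Vsupp_mono[OF that(2)]] by blast
    obtain s where s: "0 < s" "p + s *\<^sub>R (q - q') \<in> convex hull (Vsupp X Y p)"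
      using exists_translate_smaller_support[OF less.prems q \<open>q \<noteq> q'\<close> le le'] hull by blast
    obtain t where t: "0 < t" "p + t *\<^sub>R (q' - q) \<in> convex hull (Vsupp X Y p)"
      using exists_translate_smaller_support[OF less.prems q(2,1) \<open>q \<noteq> q'\<close>[symmetric] le' le] hull
      by blast
    have "(t / (s + t)) *\<^sub>R (p + s *\<^sub>R (q - q')) + (1 - t / (s + t)) *\<^sub>R (p + t *\<^sub>R (q' - q))
        \<in> convex hull (Vsupp X Y p)"
      by (rule convexD[OF convex_convex_hull s(2) t(2)]) (use s(1) t(1) in auto)
    also have "p + t *\<^sub>R (q' - q) = p - t *\<^sub>R (q - q')"
      by (simp add: algebra_simps)
    finally show ?thesis
      by (simp only: convex_combination_opposite[OF s(1) t(1)])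
  qed
qed

text \<open>If \<open>q \<preceq> p\<close> and \<open>q \<noteq> p\<close>, the segment from
  \<open>q\<close> to \<open>p\<close> can be prolonged beyond \<open>p\<close>, so \<open>p\<close>
  is no vertex. Conversely, every component of positive weight in a convex combination lies below it
  and thus equals \<open>p\<close>.\<close>

lemma vertex_iff:
  assumes p: "p \<in> sDist X Y"
  shows "is_vertex X Y p \<longleftrightarrow> (\<forall>q\<in>sDist X Y. sdist_le X Y q p \<longrightarrow> q = p)"
proof
  assume v: "is_vertex X Y p"
  show "\<forall>q\<in>sDist X Y. sdist_le X Y q p \<longrightarrow> q = p"
  proof (intro ballI impI, rule ccontr)
    fix q assume q: "q \<in> sDist X Y" "sdist_le X Y q p" and "q \<noteq> p"
    obtain t where t: "0 < t" "p + t *\<^sub>R (p - q) \<in> sDist X Y"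
      using exists_translate_smaller_support[OF p p q(1) \<open>q \<noteq> p\<close>[symmetric] sdist_le_refl q(2)]
      by blast
    \<comment> \<open>Steps \<open>t\<close> and \<open>1\<close> in opposite directions along
      \<open>p - q\<close>: going back by 1 reaches \<open>q\<close>, whose weight is
      \<open>t / (t + 1)\<close>.\<close>
    have "p = (1 - 1 / (t + 1)) *\<^sub>R q + (1 - (1 - 1 / (t + 1))) *\<^sub>R (p + t *\<^sub>R (p - q))"
      using convex_combination_opposite[OF t(1) zero_less_one, of p "p - q"]
      by (simp add: add.commute)
    moreover have "0 < 1 - 1 / (t + 1)" "1 - 1 / (t + 1) \<le> 1" using t(1) by auto
    ultimately have "p = q" using v q(1) t(2) unfolding is_vertex_def by blast
    then show False using \<open>q \<noteq> p\<close> by simp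
  qed
next
  assume min: "\<forall>q\<in>sDist X Y. sdist_le X Y q p \<longrightarrow> q = p"
  show "is_vertex X Y p"
    unfolding is_vertex_def
  proof (intro conjI p ballI allI impI)
    fix q q' \<alpha> assume "q \<in> sDist X Y" "q' \<in> sDist X Y"
      and "0 < \<alpha> \<and> \<alpha> \<le> 1 \<and> p = \<alpha> *\<^sub>R q + (1 - \<alpha>) *\<^sub>R q'"
    then show "p = q" using min sdist_le_convex_combination by metis
  qed
qed

end

section \<open>Passing to restrictions\<close>

lemma generated_sset_exists:
  assumes "simplicial_set X" "finitely_generated X" "\<And>n. finite (simplices Y n)"
  obtains G where "generated_sset X Y G"
proof -
  obtain G where "finite G" "G \<subseteq> (SIGMA n:UNIV. simplices X n)"
    and "\<And>A. simplicial_subset X A \<Longrightarrow> \<forall>(n, x)\<in>G. x \<in> A n \<Longrightarrow> A = simplices X"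
    using assms(2) unfolding finitely_generated_def by blast
  then have "generated_sset X Y G"
    using assms by unfold_locales blast+
  then show thesis by (rule that)
qed

text \<open>Over the finitely generated subobject, the restriction of \<open>q\<close> lies in the
  hull of its own vertex support. Since \<open>q \<preceq> p\<close> restricts to \<open>A\<close>,
  that support is contained in the one of the restriction of \<open>p\<close>.\<close>

lemma restrict_in_convex_hull_Vsupp:
  fixes X :: "'a sset" and Y :: "'b sset"
  assumes "simplicial_set X" "finitely_generated X" "\<And>n. finite (simplices Y n)"
    and A: "simplicial_subset X A" and q: "q \<in> sDist X Y" and le: "sdist_le X Y q p"
  shows "sdist_restrict q A \<in> convex hull (Vsupp (subsset X A) Y (sdist_restrict p A))"
proof -
  obtain G where G: "generated_sset (subsset X A) Y G"
    using generated_sset_exists simplicial_set_subsset finitely_generated_subsset assms by metis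
  show ?thesis
    using generated_sset.in_convex_hull_Vsupp[OF G sdist_restrict_in_sDist[OF q A]]
      hull_mono[OF Vsupp_mono[OF sdist_le_restrict[OF A le]]] by blast
qed

theorem theorem5p3:
  fixes X :: "'a sset" and Y :: "'b sset"
    and A B :: "nat \<Rightarrow> 'a set"
    and p :: "nat \<Rightarrow> 'a \<Rightarrow> 'b \<Rightarrow> real"
  assumes "simplicial_set X" and "finitely_generated X"
    and "simplicial_set Y" and "\<And>n. finite (simplices Y n)"
    and "simplicial_subset X A" and "simplicial_subset X B"
    and "\<And>n. simplices X n = A n \<union> B n"
    and "p \<in> sDist X Y"
  shows "is_vertex X Y p \<longleftrightarrow>
    (\<forall>q. q \<in> sDist X Y \<and>
         sdist_restrict q A \<in> convex hull (Vsupp (subsset X A) Y (sdist_restrict p A)) \<and>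
         sdist_restrict q B \<in> convex hull (Vsupp (subsset X B) Y (sdist_restrict p B))
       \<longleftrightarrow> q = p)"
proof -
  \<comment> \<open>For a fixed \<open>q\<close> the two hull conditions together amount to
    \<open>q \<preceq> p\<close>, which reduces the claim to \<open>vertex_iff\<close>.\<close>
  have "sdist_restrict q A \<in> convex hull (Vsupp (subsset X A) Y (sdist_restrict p A)) \<and>
      sdist_restrict q B \<in> convex hull (Vsupp (subsset X B) Y (sdist_restrict p B))
    \<longleftrightarrow> sdist_le X Y q p" (is "?hulls \<longleftrightarrow> _") if q: "q \<in> sDist X Y" for q
  proof
    assume ?hulls
    then have "sdist_le (subsset X A) Y (sdist_restrict q A) (sdist_restrict p A)"
      "sdist_le (subsset X B) Y (sdist_restrict q B) (sdist_restrict p B)"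
      by (blast intro: convex_hull_Vsupp_le)+
    \<comment> \<open>Every simplex lies in \<open>A\<close> or \<open>B\<close>, and the
      corresponding restriction keeps the values there.\<close>
    then show "sdist_le X Y q p"
      using assms(7) by (auto simp: sdist_le_def sdist_restrict_def)
  next
    assume le: "sdist_le X Y q p"
    show ?hulls
      using restrict_in_convex_hull_Vsupp[OF assms(1,2,4) _ q le] assms(5,6) by blast
  qed
  moreover obtain G where "generated_sset X Y G"
    using generated_sset_exists assms(1,2,4) by metis
  \<comment> \<open>Reflexivity of \<open>\<preceq>\<close> gives the existence half:
    \<open>p\<close> itself satisfies the hull conditions.\<close>
  ultimately show ?thesis
    using generated_sset.vertex_iff[of X Y G p] assms(8) sdist_le_refl[of X Y p] by auto
qed

end
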